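(* (Zipper lemma) Let $n\ge 1$, let $G$ be a $2n$-acyclic Cayley graph with generator set $E$, let $v,u\in G$, and let $$v,\alpha_1,t_2,\alpha_2,t_3,\dots,t_\ell,\alpha_\ell,u\qquad\text{and}\qquad v,\beta_1,r_2,\beta_2,r_3,\dots,r_k,\beta_k,u$$ be two coset paths from $v$ to $u$ of lengths $\ell,k\leq n$. Put $t_1=r_1=v$, $t_{\ell+1}=r_{k+1}=u$ and $\alpha_0=\alpha_{\ell+1}=\beta_0=\beta_{k+1}=\emptyset$. Then 1. $[v]_{\beta_1\cap\alpha_1}\cap[t_2]_{\alpha_1\cap\alpha_2}\neq\emptyset$ or $[v]_{\alpha_1\cap\beta_1}\cap[r_2]_{\beta_1\cap\beta_2}\neq\emptyset$; and 2. $[u]_{\beta_k\cap\alpha_\ell}\cap[t_\ell]_{\alpha_\ell\cap\alpha_{\ell-1}}\neq\emptyset$ or $[u]_{\alpha_\ell\cap\beta_k}\cap[r_k]_{\beta_k\cap\beta_{k-1}}\neq\emptyset$.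
   Context: A Cayley group is a group $G$ (finite or infinite) with a generating set $E\subseteq G$ of non-trivial involutions ($e\neq 1$, $e^2=1$ for $e\in E$). Its Cayley graph, also denoted $G$, has vertex set $G$ and $e$-labelled edges $\{v,ve\}$ for $v\in G$, $e\in E$. For $\alpha\subseteq E$, $G_\alpha$ is the subgroup generated by $\alpha$, and $[v]_\alpha=vG_\alpha$ is the $\alpha$-coset of $v$. A coset cycle of length $m$ in $G$ is a sequence $((v_i,\alpha_i))_{i\in\mathbb{Z}_m}$ with $v_i\in G$, $\alpha_i\subseteq E$, such that for all $i\in\mathbb{Z}_m$: $v_i^{-1}v_{i+1}\in G_{\alpha_i}$ and $[v_i]_{\alpha_{i-1}\cap\alpha_i}\cap[v_{i+1}]_{\alpha_i\cap\alpha_{i+1}}=\emptyset$. $G$ is $n$-acyclic if it has no coset cycle of length at most $n$. A coset path of length $\ell\geq1$ from $v_1$ to $v_{\ell+1}$ is a sequence $v_1,\alpha_1,v_2,\dots,\alpha_\ell,v_{\ell+1}$ with $v_i\in G$, $\alpha_i\subseteq E$, $v_i^{-1}v_{i+1}\in G_{\alpha_i}$ for $1\le i\le\ell$, and $[v_i]_{\alpha_{i-1}\cap\alpha_i}\cap[v_{i+1}]_{\alpha_i\cap\alpha_{i+1}}=\emptyset$ for all $1\leq i\leq\ell$, where $\alpha_0=\alpha_{\ell+1}=\emptyset$. *)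

theory Defs
  imports "HOL-Algebra.Coset" "HOL-Algebra.Generated_Groups"
begin

(* The Cayley graph of (G, E) is determined by the group G and the generating set E,
   and the notions below refer to the Cayley graph only through cosets, so the pair
   (G, E) stands for the graph as well. *)
locale cayley_group = group G for G (structure) +
  fixes E :: "'a set"
  assumes gens_closed: "E \<subseteq> carrier G"
    and gens_nontrivial: "e \<in> E \<Longrightarrow> e \<noteq> \<one>"
    and gens_involution: "e \<in> E \<Longrightarrow> e \<otimes> e = \<one>"
    and gens_generate: "generate G E = carrier G"

(* The coset [v]_A = v G_A. *)
definition gen_coset :: "('a, 'b) monoid_scheme \<Rightarrow> 'a \<Rightarrow> 'a set \<Rightarrow> 'a set" where
  "gen_coset G v A = v <#\<^bsub>G\<^esub> generate G A"

(* The index set Z_m is represented by the residues 0, ..., m - 1 (with m positive): the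
   successor of i is Suc i mod m and its predecessor is (i + m - 1) mod m.  The values of
   v and A at other indices are irrelevant. *)
definition coset_cycle ::
  "('a, 'b) monoid_scheme \<Rightarrow> 'a set \<Rightarrow> nat \<Rightarrow> (nat \<Rightarrow> 'a) \<Rightarrow> (nat \<Rightarrow> 'a set) \<Rightarrow> bool" where
  "coset_cycle G E m v A \<longleftrightarrow>
     m \<ge> 1 \<and>
     (\<forall>i<m. v i \<in> carrier G \<and> A i \<subseteq> E) \<and>
     (\<forall>i<m. inv\<^bsub>G\<^esub> (v i) \<otimes>\<^bsub>G\<^esub> v (Suc i mod m) \<in> generate G (A i) \<and>
            gen_coset G (v i) (A ((i + m - 1) mod m) \<inter> A i) \<inter>
            gen_coset G (v (Suc i mod m)) (A i \<inter> A (Suc i mod m)) = {})"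

definition n_acyclic :: "('a, 'b) monoid_scheme \<Rightarrow> 'a set \<Rightarrow> nat \<Rightarrow> bool" where
  "n_acyclic G E n \<longleftrightarrow> (\<forall>m v A. m \<le> n \<longrightarrow> \<not> coset_cycle G E m v A)"

(* A coset path v 1, A 1, v 2, ..., A l, v (l + 1) of length l from a to b.  The convention
   that the index sets numbered 0 and l + 1 are empty is part of the predicate. *)
definition coset_path ::
  "('a, 'b) monoid_scheme \<Rightarrow> 'a set \<Rightarrow> nat \<Rightarrow> 'a \<Rightarrow> 'a \<Rightarrow> (nat \<Rightarrow> 'a) \<Rightarrow> (nat \<Rightarrow> 'a set) \<Rightarrow> bool" where
  "coset_path G E l a b v A \<longleftrightarrow>
     l \<ge> 1 \<and> v 1 = a \<and> v (l + 1) = b \<and> A 0 = {} \<and> A (l + 1) = {} \<and>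
     (\<forall>i\<in>{1..l + 1}. v i \<in> carrier G) \<and>
     (\<forall>i\<in>{1..l}. A i \<subseteq> E) \<and>
     (\<forall>i\<in>{1..l}. inv\<^bsub>G\<^esub> (v i) \<otimes>\<^bsub>G\<^esub> v (i + 1) \<in> generate G (A i) \<and>
                 gen_coset G (v i) (A (i - 1) \<inter> A i) \<inter>
                 gen_coset G (v (i + 1)) (A i \<inter> A (i + 1)) = {})"

end

theory Submission imports Defs begin

text \<open>
  In an \<open>N\<close>-acyclic Cayley graph no coset path of length at most \<open>N\<close> is closed: read cyclically,
  a closed coset path can violate the disjointness conditions of a coset cycle only at its base point, and
  an element witnessing the violation is the base point of a shorter closed coset path.
  If the first claim of the zipper lemma failed, then running back along the second path from
  \<open>u\<close> to \<open>v\<close> and then along the first one from \<open>v\<close> to \<open>u\<close> would be a closed coset path; if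
  the second claim failed, the same would hold with the roles of \<open>u\<close> and \<open>v\<close> exchanged.
\<close>

context group
begin

section \<open>Cosets of generated subgroups\<close>

lemma mem_gen_coset_iff:
  assumes "x \<in> carrier G" "A \<subseteq> carrier G"
  shows "y \<in> gen_coset G x A \<longleftrightarrow> y \<in> carrier G \<and> inv x \<otimes> y \<in> generate G A"
proof -
  have "generate G A \<subseteq> carrier G"
    using generate_incl assms by blast
  then show ?thesis
    using assms unfolding gen_coset_def l_coset_def
    by (auto simp: inv_solve_left' m_assoc[symmetric] intro!: bexI[of _ "inv x \<otimes> y"])
qed

lemma gen_coset_refl:
  assumes "x \<in> carrier G" "A \<subseteq> carrier G"
  shows "x \<in> gen_coset G x A"
  using assms by (simp add: mem_gen_coset_iff generate.one)

lemma gen_coset_empty: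
  assumes "x \<in> carrier G"
  shows "gen_coset G x {} = {x}"
  using assms by (auto simp: gen_coset_def l_coset_def generate_empty)

lemma gen_coset_mono:
  assumes "A \<subseteq> B"
  shows "gen_coset G x A \<subseteq> gen_coset G x B"
  using mono_generate[OF assms] by (auto simp: gen_coset_def l_coset_def)

lemma gen_coset_eq:
  assumes "x \<in> carrier G" "A \<subseteq> carrier G" "y \<in> gen_coset G x A"
  shows "gen_coset G y A = gen_coset G x A"
  using assms generate_is_subgroup[of A] l_repr_independence[of y x "generate G A"]
  by (simp add: gen_coset_def)

lemma gen_coset_sym:
  assumes "x \<in> carrier G" "A \<subseteq> carrier G" "y \<in> gen_coset G x A"
  shows "x \<in> gen_coset G y A"
  using assms gen_coset_eq gen_coset_refl by blast

section \<open>Coset paths: index-shifted form, reversal, shortening and joining\<close>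

text \<open>Steps are phrased as coset membership so that \<open>gen_coset_eq\<close> can change the
  representative, and counting from \<open>Suc i\<close> removes the truncated subtraction
  \<open>i - 1\<close>.\<close>

lemma coset_path_iff:
  assumes "E \<subseteq> carrier G"
  shows "coset_path G E l a b v A \<longleftrightarrow>
     l \<ge> 1 \<and> v (Suc 0) = a \<and> v (Suc l) = b \<and> A 0 = {} \<and> A (Suc l) = {} \<and>
     (\<forall>i\<le>l. v (Suc i) \<in> carrier G) \<and>
     (\<forall>i<l. A (Suc i) \<subseteq> E) \<and>
     (\<forall>i<l. v (Suc (Suc i)) \<in> gen_coset G (v (Suc i)) (A (Suc i))) \<and>
     (\<forall>i<l. gen_coset G (v (Suc i)) (A i \<inter> A (Suc i)) \<inter>
            gen_coset G (v (Suc (Suc i))) (A (Suc i) \<inter> A (Suc (Suc i))) = {})"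
proof -
  have *: "{1..l} = Suc ` {..<l}" "{1..l + 1} = Suc ` {..l}"
    by (simp_all add: image_Suc_lessThan image_Suc_atMost)
  have "inv (v (Suc i)) \<otimes> v (Suc (Suc i)) \<in> generate G (A (Suc i)) \<longleftrightarrow>
      v (Suc (Suc i)) \<in> gen_coset G (v (Suc i)) (A (Suc i))"
    if "\<forall>i\<le>l. v (Suc i) \<in> carrier G" "\<forall>i<l. A (Suc i) \<subseteq> E" "i < l" for i
  proof -
    have "A (Suc i) \<subseteq> carrier G" "v (Suc i) \<in> carrier G" "v (Suc (Suc i)) \<in> carrier G"
      using that assms by (blast, simp, simp)
    then show ?thesis by (simp add: mem_gen_coset_iff)
  qed
  then show ?thesis unfolding coset_path_def *
    by (simp add: ball_simps(9)) blast
qed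

lemma coset_pathD:
  assumes E: "E \<subseteq> carrier G" and p: "coset_path G E l a b v A"
  shows "l \<ge> 1" "v (Suc 0) = a" "v (Suc l) = b" "A 0 = {}" "A (Suc l) = {}"
    and "\<And>i. i \<le> l \<Longrightarrow> v (Suc i) \<in> carrier G"
    and "\<And>i. i < l \<Longrightarrow> A (Suc i) \<subseteq> E"
    and "\<And>i. i < l \<Longrightarrow> A (Suc i) \<subseteq> carrier G"
    and "\<And>i. i < l \<Longrightarrow> v (Suc (Suc i)) \<in> gen_coset G (v (Suc i)) (A (Suc i))"
    and "\<And>i. i < l \<Longrightarrow> gen_coset G (v (Suc i)) (A i \<inter> A (Suc i)) \<inter>
            gen_coset G (v (Suc (Suc i))) (A (Suc i) \<inter> A (Suc (Suc i))) = {}"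
  using p E unfolding coset_path_iff[OF E] by blast+

text \<open>Vertices are reflected in \<open>l + 2\<close> and sets in \<open>l + 1\<close>, since
  vertices carry the indices 1 to \<open>l + 1\<close> but sets 0 to \<open>l + 1\<close>. Reversal
  carries statements about the start of a path over to its end.\<close>

lemma coset_path_rev:
  assumes E: "E \<subseteq> carrier G" and p: "coset_path G E l a b v A"
  shows "coset_path G E l b a (\<lambda>i. v (l + 2 - i)) (\<lambda>i. A (l + 1 - i))"
proof -
  note q = coset_pathD[OF E p]
  have *: "A (l - i) \<subseteq> E \<and> v (l - i) \<in> gen_coset G (v (Suc (l - i))) (A (l - i)) \<and>
        gen_coset G (v (Suc (l - i))) (A (Suc (l - i)) \<inter> A (l - i)) \<inter>
        gen_coset G (v (l - i)) (A (l - i) \<inter> A (l - Suc i)) = {}"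
    if i: "i < l" for i
  proof -
    \<comment> \<open>The reversed step is step \<open>Suc j\<close> of the original path, read
      backwards.\<close>
    define j where "j = l - Suc i"
    have j: "j < l" and e: "l - i = Suc j" "l - Suc i = j"
      using i by (auto simp: j_def)
    have "v (Suc j) \<in> gen_coset G (v (Suc (Suc j))) (A (Suc j))"
      using gen_coset_sym[OF q(6) q(8) q(9)] j by simp
    then show ?thesis unfolding e using q(7,10)[OF j] by (simp add: Int_commute)
  qed
  have "l + 2 - Suc (Suc i) = l - i" "l + 1 - Suc i = l - i" "l + 1 - Suc (Suc i) = l - Suc i" for i
    by simp_all
  moreover have "l + 2 - Suc i = Suc (l - i)" "l + 1 - i = Suc (l - i)" if "i \<le> l" for i
    using that by simp_all
  ultimately show ?thesis
    unfolding coset_path_iff[OF E] using q(1-6) * by simp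
qed

text \<open>The new end \<open>x\<close> differs from the vertex it replaces by an element of the
  subgroup of \<open>A m\<close>, so the step into it survives. The new last disjointness condition
  concerns only \<open>{x}\<close>, which lies in a coset already disjoint from the relevant
  one.\<close>

lemma coset_path_butlast:
  assumes E: "E \<subseteq> carrier G" and p: "coset_path G E (Suc m) a b v A" and m: "m \<ge> 1"
    and x: "x \<in> gen_coset G (v (Suc m)) (A m \<inter> A (Suc m))"
  shows "coset_path G E m a x (v(Suc m := x)) (A(Suc m := {}))"
proof -
  obtain j where j: "m = Suc j"
    using m by (cases m) auto
  note q = coset_pathD[OF E p]
  have AE: "A m \<inter> A (Suc m) \<subseteq> carrier G" "A m \<subseteq> carrier G"
    and c: "v (Suc m) \<in> carrier G" "v m \<in> carrier G"
    using q(8)[of m] q(8)[of j] q(6)[of m] q(6)[of j] j by auto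
  have xc: "x \<in> carrier G"
    using x mem_gen_coset_iff[OF c(1) AE(1)] by blast
  have "x \<in> gen_coset G (v (Suc m)) (A m)"
    using x gen_coset_mono[of "A m \<inter> A (Suc m)" "A m"] by auto
  then have step: "x \<in> gen_coset G (v m) (A m)"
    using gen_coset_eq[OF c(2) AE(2)] q(9)[of j] j by auto
  have disj: "gen_coset G (v m) (A j \<inter> A m) \<inter> gen_coset G x {} = {}"
    using q(10)[of j] x j gen_coset_empty[OF xc] by auto
  show ?thesis
    unfolding coset_path_iff[OF E]
  proof (intro conjI allI impI)
    fix i assume i: "i < m"
    show "(v(Suc m := x)) (Suc (Suc i)) \<in>
        gen_coset G ((v(Suc m := x)) (Suc i)) ((A(Suc m := {})) (Suc i))"
      using q(9)[of i] i j step by (cases "i = j") simp_all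
    show "gen_coset G ((v(Suc m := x)) (Suc i)) ((A(Suc m := {})) i \<inter> (A(Suc m := {})) (Suc i)) \<inter>
        gen_coset G ((v(Suc m := x)) (Suc (Suc i)))
          ((A(Suc m := {})) (Suc i) \<inter> (A(Suc m := {})) (Suc (Suc i))) = {}"
      using q(10)[of i] i j disj by (cases "i = j") simp_all
  qed (use q(1-7) m xc in simp_all)
qed

text \<open>Mirror image of \<open>coset_path_butlast\<close>. Shifting the indices would put
  \<open>A 1\<close> at index 0, so that value is reset to the empty set.\<close>

lemma coset_path_tl:
  assumes E: "E \<subseteq> carrier G" and p: "coset_path G E (Suc m) a b v A" and m: "m \<ge> 1"
    and x: "x \<in> gen_coset G (v 2) (A 1 \<inter> A 2)"
  shows "coset_path G E m x b ((\<lambda>i. v (Suc i))(1 := x)) ((\<lambda>i. A (Suc i))(0 := {}))"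
proof -
  note q = coset_pathD[OF E p]
  have AE: "A 1 \<inter> A 2 \<subseteq> carrier G" "A 2 \<subseteq> carrier G" and c: "v 2 \<in> carrier G"
    using q(8)[of 1] q(6)[of 1] m by (auto simp: numeral_2_eq_2)
  have xc: "x \<in> carrier G"
    using x mem_gen_coset_iff[OF c AE(1)] by blast
  have "x \<in> gen_coset G (v 2) (A 2)"
    using x gen_coset_mono[of "A 1 \<inter> A 2" "A 2"] by auto
  then have step: "v (Suc 2) \<in> gen_coset G x (A 2)"
    using gen_coset_eq[OF c AE(2)] q(9)[of 1] m by (auto simp: numeral_2_eq_2)
  have disj: "gen_coset G x {} \<inter> gen_coset G (v (Suc 2)) (A 2 \<inter> A (Suc 2)) = {}"
    using q(10)[of 1] x m gen_coset_empty[OF xc] by (auto simp: numeral_2_eq_2)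
  show ?thesis
    unfolding coset_path_iff[OF E]
  proof (intro conjI allI impI)
    fix i assume i: "i < m"
    show "((\<lambda>i. v (Suc i))(1 := x)) (Suc (Suc i)) \<in>
        gen_coset G (((\<lambda>i. v (Suc i))(1 := x)) (Suc i)) (((\<lambda>i. A (Suc i))(0 := {})) (Suc i))"
      using q(9)[of "Suc i"] i step by (cases i) (simp_all add: numeral_2_eq_2)
    show "gen_coset G (((\<lambda>i. v (Suc i))(1 := x)) (Suc i))
          (((\<lambda>i. A (Suc i))(0 := {})) i \<inter> ((\<lambda>i. A (Suc i))(0 := {})) (Suc i)) \<inter>
        gen_coset G (((\<lambda>i. v (Suc i))(1 := x)) (Suc (Suc i)))
          (((\<lambda>i. A (Suc i))(0 := {})) (Suc i) \<inter> ((\<lambda>i. A (Suc i))(0 := {})) (Suc (Suc i))) = {}"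
      using q(10)[of "Suc i"] i disj by (cases i) (simp_all add: numeral_2_eq_2)
  qed (use q(1-7) m xc in simp_all)
qed

text \<open>The end occurs in a single disjointness condition, with the trivial coset
  \<open>{x}\<close>, and the second assumption on \<open>x\<close> is that condition.\<close>

lemma coset_path_change_end:
  assumes E: "E \<subseteq> carrier G" and p: "coset_path G E (Suc m) a b v A"
    and x: "x \<in> gen_coset G b (A (Suc m))" "x \<notin> gen_coset G (v (Suc m)) (A m \<inter> A (Suc m))"
  shows "coset_path G E (Suc m) a x (v(Suc (Suc m) := x)) A"
proof -
  note q = coset_pathD[OF E p]
  have AE: "A (Suc m) \<subseteq> carrier G" and c: "b \<in> carrier G" "v (Suc m) \<in> carrier G"
    using q(3) q(8)[of m] q(6)[of "Suc m"] q(6)[of m] by auto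
  have xc: "x \<in> carrier G"
    using x(1) mem_gen_coset_iff[OF c(1) AE] by blast
  have step: "x \<in> gen_coset G (v (Suc m)) (A (Suc m))"
    using gen_coset_eq[OF c(2) AE] q(3) q(9)[of m] x(1) by auto
  have disj: "gen_coset G (v (Suc m)) (A m \<inter> A (Suc m)) \<inter> gen_coset G x {} = {}"
    using x(2) gen_coset_empty[OF xc] by auto
  show ?thesis
    unfolding coset_path_iff[OF E]
  proof (intro conjI allI impI)
    fix i assume i: "i < Suc m"
    show "(v(Suc (Suc m) := x)) (Suc (Suc i)) \<in>
        gen_coset G ((v(Suc (Suc m) := x)) (Suc i)) (A (Suc i))"
      using q(9)[of i] i step by (cases "i = m") simp_all
    show "gen_coset G ((v(Suc (Suc m) := x)) (Suc i)) (A i \<inter> A (Suc i)) \<inter>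
        gen_coset G ((v(Suc (Suc m) := x)) (Suc (Suc i))) (A (Suc i) \<inter> A (Suc (Suc i))) = {}"
      using q(10)[of i] q(5) i disj by (cases "i = m") simp_all
  qed (use q(1-7) xc in simp_all)
qed

text \<open>At the junction each path alone only keeps its neighbouring coset away from
  \<open>{b}\<close>. Joined, both must avoid the larger coset of \<open>b\<close> for
  \<open>A l \<inter> B 1\<close>, as \<open>d\<close> and \<open>d'\<close> provide.\<close>

lemma coset_path_append:
  assumes E: "E \<subseteq> carrier G"
    and p: "coset_path G E l a b v A" and p': "coset_path G E k b c w B"
    and d: "gen_coset G (v l) (A (l - 1) \<inter> A l) \<inter> gen_coset G b (A l \<inter> B 1) = {}"
    and d': "gen_coset G b (A l \<inter> B 1) \<inter> gen_coset G (w 2) (B 1 \<inter> B 2) = {}"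
  shows "coset_path G E (l + k) a c
    (\<lambda>i. if i \<le> l then v i else w (i - l)) (\<lambda>i. if i \<le> l then A i else B (i - l))"
    (is "coset_path G E _ a c ?v ?A")
proof -
  note q = coset_pathD[OF E p]
  note q' = coset_pathD[OF E p']
  have *: "?v (Suc (Suc i)) \<in> gen_coset G (?v (Suc i)) (?A (Suc i)) \<and>
      gen_coset G (?v (Suc i)) (?A i \<inter> ?A (Suc i)) \<inter>
      gen_coset G (?v (Suc (Suc i))) (?A (Suc i) \<inter> ?A (Suc (Suc i))) = {} \<and>
      ?A (Suc i) \<subseteq> E"
    if i: "i < l + k" for i
  proof -
    \<comment> \<open>The middle cases are the two steps meeting at \<open>b\<close>: the last of
      the first path uses \<open>d\<close>, the first of the second path uses
      \<open>d'\<close>.\<close>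
    consider "Suc i < l" | "Suc i = l" | "i = l" | j where "i = l + Suc j" "Suc j < k"
      using i by (metis add_Suc_right less_antisym less_imp_Suc_add linorder_neqE_nat
        nat_add_left_cancel_less not_less_eq)
    then show ?thesis
    proof cases
      case 1
      then show ?thesis using q(7,9,10)[of i] by simp
    next
      case 2
      then show ?thesis using q(3) q'(2) q(7,9)[of i] d by (auto simp: Suc_diff_le)
    next
      case 3
      then show ?thesis using q'(1,2) q'(7,9)[of 0] d' by (simp add: Suc_diff_le numeral_2_eq_2)
    next
      case 4
      then show ?thesis using q'(7,9,10)[of "Suc j"] by (simp add: Suc_diff_le)
    qed
  qed
  moreover have "?v (Suc i) \<in> carrier G" if "i \<le> l + k" for i
    using that q(6)[of i] q'(6)[of "i - l"] by (simp add: Suc_diff_le)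
  ultimately show ?thesis
    unfolding coset_path_iff[OF E] using q(1-5) q'(1-5) by (simp add: Suc_diff_le)
qed

section \<open>Closed coset paths in acyclic groups\<close>

text \<open>Closing up replaces the empty sets at indices 0 and \<open>m + 1\<close> by the cyclic
  neighbours \<open>A m\<close> and \<open>A 1\<close>; only the conditions at the base point become
  stronger, and these are \<open>d\<close> and \<open>d'\<close>.\<close>

lemma coset_cycle_of_closed_coset_path:
  assumes E: "E \<subseteq> carrier G" and p: "coset_path G E m a a v A" and m: "m \<ge> 2"
    and d: "gen_coset G a (A m \<inter> A 1) \<inter> gen_coset G (v 2) (A 1 \<inter> A 2) = {}"
    and d': "gen_coset G (v m) (A (m - 1) \<inter> A m) \<inter> gen_coset G a (A m \<inter> A 1) = {}"
  shows "coset_cycle G E m (\<lambda>i. v (Suc i)) (\<lambda>i. A (Suc i))"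
proof -
  note q = coset_pathD[OF E p]
  have "inv (v (Suc i)) \<otimes> v (Suc (Suc i mod m)) \<in> generate G (A (Suc i)) \<and>
      gen_coset G (v (Suc i)) (A (Suc ((i + m - 1) mod m)) \<inter> A (Suc i)) \<inter>
      gen_coset G (v (Suc (Suc i mod m))) (A (Suc i) \<inter> A (Suc (Suc i mod m))) = {}"
    if i: "i < m" for i
  proof -
    have step: "inv (v (Suc i)) \<otimes> v (Suc (Suc i)) \<in> generate G (A (Suc i))"
      using mem_gen_coset_iff[OF q(6) q(8), of i i] q(9)[OF i] i by simp
    have pred: "Suc ((i + m - 1) mod m) = i" if "i > 0"
    proof -
      have "(i + m - 1) mod m = (i - 1 + m) mod m" using that by simp
      also have "\<dots> = i - 1" using i by (simp only: mod_add_self2) simp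
      finally show ?thesis using that by simp
    qed
    consider "i = 0" | "i > 0" "Suc i < m" | "Suc i = m" using i by linarith
    then show ?thesis
    proof cases
      case 1
      then show ?thesis using q(2) step d m by (simp add: numeral_2_eq_2)
    next
      case 2
      then show ?thesis using step q(10)[of i] pred by simp
    next
      case 3
      then have "i > 0" using m by simp
      then show ?thesis using 3 q(2,3) step d' pred by auto
    qed
  qed
  then show ?thesis
    unfolding coset_cycle_def using q(6,7) m by simp
qed

text \<open>Dropping the first step makes \<open>x\<close> the start. The end is then moved from
  \<open>a\<close> to \<open>x\<close> along \<open>A m\<close>, or the last step is dropped as well
  when that move would break disjointness.\<close>

lemma coset_path_closed_shorten:
  assumes E: "E \<subseteq> carrier G" and p: "coset_path G E m a a v A" and m: "m \<ge> 2"
    and x: "x \<in> gen_coset G a (A m \<inter> A 1)" "x \<in> gen_coset G (v 2) (A 1 \<inter> A 2)"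
  shows "\<exists>m' < m. \<exists>v' A'. coset_path G E m' x x v' A'"
proof (cases "m = 2")
  case True
  note q = coset_pathD[OF E p]
  have c: "a \<in> carrier G" "v 2 \<in> carrier G" "A 1 \<inter> A 2 \<subseteq> carrier G"
    using q(2) q(6)[of 0] q(6)[of 1] q(8)[of 1] True by (auto simp: numeral_2_eq_2)
  \<comment> \<open>For length 2 the situation is contradictory: both cosets belong to the same
    subgroup and share \<open>x\<close>, so they coincide, but the last step keeps \<open>a\<close>
    out of the second.\<close>
  have "gen_coset G a (A 1 \<inter> A 2) = gen_coset G (v 2) (A 1 \<inter> A 2)"
    using x True gen_coset_eq[OF c(1,3), of x] gen_coset_eq[OF c(2,3), of x]
    by (simp add: Int_commute)
  then have "a \<in> gen_coset G (v 2) (A 1 \<inter> A 2)"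
    using gen_coset_refl[OF c(1,3)] by simp
  moreover have "gen_coset G (v 2) (A 1 \<inter> A 2) \<inter> gen_coset G a {} = {}"
    using q(10)[of 1] q(3,5) True by (simp add: numeral_2_eq_2)
  ultimately show ?thesis
    using gen_coset_empty[OF c(1)] by auto
next
  case False
  then obtain j where j: "m = Suc (Suc (Suc j))"
    using m by (intro that[of "m - 3"]) simp
  let ?v = "(\<lambda>i. v (Suc i))(1 := x)" and ?A = "(\<lambda>i. A (Suc i))(0 := {})"
  have p': "coset_path G E (Suc (Suc j)) x a ?v ?A"
    using coset_path_tl[OF E p[unfolded j] _ x(2)] by simp
  \<comment> \<open>Here \<open>?v (Suc (Suc j))\<close> is \<open>v m\<close>, the last vertex
    before the end. If \<open>x\<close> lies in its coset, the path can stop there, with length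
    \<open>m - 2\<close>; otherwise its length is \<open>m - 1\<close>.\<close>
  show ?thesis
  proof (cases "x \<in> gen_coset G (?v (Suc (Suc j))) (?A (Suc j) \<inter> ?A (Suc (Suc j)))")
    case True
    have "Suc j < m" using j by simp
    moreover have "1 \<le> Suc j" by simp
    ultimately show ?thesis
      using coset_path_butlast[OF E p' _ True] by blast
  next
    case False
    have "Suc (Suc j) < m" using j by simp
    moreover have "x \<in> gen_coset G a (?A (Suc (Suc j)))"
      using x(1) j gen_coset_mono[of "A m \<inter> A 1" "A m" a] by auto
    ultimately show ?thesis
      using coset_path_change_end[OF E p' _ False] by blast
  qed
qed

lemma no_closed_coset_path:
  assumes E: "E \<subseteq> carrier G" and acyclic: "n_acyclic G E N" and "m \<le> N"
  shows "\<not> coset_path G E m a a v A"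
  using \<open>m \<le> N\<close>
\<comment> \<open>The base point is generalized because shortening moves it to the witness.\<close>
proof (induction m arbitrary: a v A rule: less_induct)
  case (less m)
  show ?case
  proof
    assume p: "coset_path G E m a a v A"
    note q = coset_pathD[OF E p]
    have a: "a \<in> carrier G" using q(2) q(6)[of 0] by simp
    show False
    proof (cases "m = 1")
      case True
      then have "gen_coset G a {} \<inter> gen_coset G a {} = {}"
        using q(10)[of 0] q(2-5) by simp
      then show False using gen_coset_empty[OF a] by simp
    next
      case False
      then have m: "m \<ge> 2" using q(1) by simp
      have "\<not> coset_cycle G E m (\<lambda>i. v (Suc i)) (\<lambda>i. A (Suc i))"
        using acyclic less.prems by (simp add: n_acyclic_def)
      then consider
          x where "x \<in> gen_coset G a (A m \<inter> A 1)" "x \<in> gen_coset G (v 2) (A 1 \<inter> A 2)"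
        | x where "x \<in> gen_coset G (v m) (A (m - 1) \<inter> A m)" "x \<in> gen_coset G a (A m \<inter> A 1)"
        using coset_cycle_of_closed_coset_path[OF E p m] by blast
      then obtain m' x v' A' where "m' < m" "coset_path G E m' x x v' A'"
      proof cases
        case 1
        then show thesis
          using coset_path_closed_shorten[OF E p m] that by blast
      next
        \<comment> \<open>Reversal turns a violation on the incoming side of the base point into one
          on the outgoing side.\<close>
        case 2
        have "m + 1 - m = 1" "m + 1 - 1 = m" "m + 2 - 2 = m" "m + 1 - 2 = m - 1"
          by simp_all
        then show thesis
          using coset_path_closed_shorten[OF E coset_path_rev[OF E p] m, of x] 2 that
          by (simp only: Int_commute) blast
      qed
      then show False using less by simp
    qed
  qed
qed

section \<open>Two coset paths with common ends\<close>

lemma coset_paths_share_start: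
  assumes E: "E \<subseteq> carrier G" and acyclic: "n_acyclic G E N" and N: "l + k \<le> N"
    and p: "coset_path G E l a b v A" and p': "coset_path G E k a b w B"
  shows "gen_coset G a (B 1 \<inter> A 1) \<inter> gen_coset G (v 2) (A 1 \<inter> A 2) \<noteq> {} \<or>
         gen_coset G a (A 1 \<inter> B 1) \<inter> gen_coset G (w 2) (B 1 \<inter> B 2) \<noteq> {}"
proof (rule ccontr)
  assume "\<not> ?thesis"
  moreover have "k \<ge> 1" using p' by (simp add: coset_path_def)
  \<comment> \<open>The two negated disjuncts are the junction conditions at \<open>a\<close> for
    the reversal of the second path followed by the first.\<close>
  ultimately have "\<exists>v A. coset_path G E (k + l) b b v A"
    using coset_path_append[OF E coset_path_rev[OF E p'] p]
    by (auto simp: Int_commute numeral_2_eq_2)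
  then show False
    using no_closed_coset_path[OF E acyclic] N by (simp add: add.commute)
qed

end


theorem lemma4p8:
  fixes G :: "('a, 'b) monoid_scheme" and E :: "'a set"
    and n l k :: nat and v u :: 'a
    and t r :: "nat \<Rightarrow> 'a" and \<alpha> \<beta> :: "nat \<Rightarrow> 'a set"
  assumes "cayley_group G E"
    and "n \<ge> 1"
    and "n_acyclic G E (2 * n)"
    and "v \<in> carrier G" and "u \<in> carrier G"
    and "coset_path G E l v u t \<alpha>" and "l \<le> n"
    and "coset_path G E k v u r \<beta>" and "k \<le> n"
  shows "(gen_coset G v (\<beta> 1 \<inter> \<alpha> 1) \<inter> gen_coset G (t 2) (\<alpha> 1 \<inter> \<alpha> 2) \<noteq> {} \<or>
          gen_coset G v (\<alpha> 1 \<inter> \<beta> 1) \<inter> gen_coset G (r 2) (\<beta> 1 \<inter> \<beta> 2) \<noteq> {}) \<and>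
         (gen_coset G u (\<beta> k \<inter> \<alpha> l) \<inter> gen_coset G (t l) (\<alpha> l \<inter> \<alpha> (l - 1)) \<noteq> {} \<or>
          gen_coset G u (\<alpha> l \<inter> \<beta> k) \<inter> gen_coset G (r k) (\<beta> k \<inter> \<beta> (k - 1)) \<noteq> {})"
proof -
  interpret cayley_group G E by fact
  have N: "l + k \<le> 2 * n" using assms by simp
  have "l \<ge> 1" "k \<ge> 1" using assms by (auto simp: coset_path_def)
  \<comment> \<open>The second claim is the first one for both reversed paths, where vertex 2
    becomes \<open>t l\<close> or \<open>r k\<close> and the sets at 1 and 2 become those at
    \<open>l\<close> and \<open>l - 1\<close>, or \<open>k\<close> and \<open>k - 1\<close>.\<close>
  then show ?thesis
    using coset_paths_share_start[OF gens_closed assms(3) N assms(6,8)]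
      coset_paths_share_start[OF gens_closed assms(3) N
        coset_path_rev[OF gens_closed assms(6)] coset_path_rev[OF gens_closed assms(8)]]
    by auto
qed

end
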